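(* Let $A, B, C\subset\mathbb{R}$ be three pairwise disjoint intervals with $|A|=|B|=|C|=\tfrac13$, and let $\Omega=A\cup B\cup C$. If $\Omega$ is a spectral set, then $\Omega$ tiles $\mathbb{R}$ by translations.
   Context: $|\cdot|$ denotes Lebesgue measure (length). A measurable set $\Omega\subset\mathbb{R}$ of finite positive measure is a spectral set if there is a subset $\Lambda\subset\mathbb{R}$ such that the functions $e_\lambda(x)=|\Omega|^{-1/2}e^{2\pi i\lambda x}\chi_\Omega(x)$, $\lambda\in\Lambda$, form an orthonormal basis of $L^2(\Omega)$. $\Omega$ tiles $\mathbb{R}$ by translations if there is a subset $\mathcal{T}\subset\mathbb{R}$ such that the translates $\{\Omega+t : t\in\mathcal{T}\}$ form a partition of $\mathbb{R}$ up to sets of measure zero. *)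

theory Defs
  imports "HOL-Analysis.Analysis"
begin

text \<open>
  Elements of \<open>L\<^sup>2(\<Omega>)\<close> are represented by functions, without passing to classes modulo
  almost-everywhere equality; their values outside \<open>\<Omega>\<close> are irrelevant.
\<close>

definition L2_space :: "real set \<Rightarrow> (real \<Rightarrow> complex) set" where
  "L2_space \<Omega> = {f \<in> borel_measurable (lebesgue_on \<Omega>).
     integrable (lebesgue_on \<Omega>) (\<lambda>x. (cmod (f x))\<^sup>2)}"

definition L2_inner :: "real set \<Rightarrow> (real \<Rightarrow> complex) \<Rightarrow> (real \<Rightarrow> complex) \<Rightarrow> complex" where
  "L2_inner \<Omega> f g = (LINT x|lebesgue_on \<Omega>. f x * cnj (g x))"

definition L2_norm :: "real set \<Rightarrow> (real \<Rightarrow> complex) \<Rightarrow> real" where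
  "L2_norm \<Omega> f = sqrt (LINT x|lebesgue_on \<Omega>. (cmod (f x))\<^sup>2)"

text \<open>An orthonormal family in \<open>L\<^sup>2(\<Omega>)\<close> whose linear span is dense.\<close>

definition L2_orthonormal_basis :: "real set \<Rightarrow> 'i set \<Rightarrow> ('i \<Rightarrow> real \<Rightarrow> complex) \<Rightarrow> bool" where
  "L2_orthonormal_basis \<Omega> I e \<longleftrightarrow>
     (\<forall>i\<in>I. e i \<in> L2_space \<Omega>) \<and>
     (\<forall>i\<in>I. \<forall>j\<in>I. L2_inner \<Omega> (e i) (e j) = (if i = j then 1 else 0)) \<and>
     (\<forall>f\<in>L2_space \<Omega>. \<forall>\<epsilon>>0. \<exists>F c. finite F \<and> F \<subseteq> I \<and>
        L2_norm \<Omega> (\<lambda>x. f x - (\<Sum>i\<in>F. c i * e i x)) < \<epsilon>)"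

definition normalized_exponential :: "real set \<Rightarrow> real \<Rightarrow> real \<Rightarrow> complex" where
  "normalized_exponential \<Omega> \<xi> x =
     of_real (measure lebesgue \<Omega> powr (-1/2)) * exp (2 * of_real pi * \<i> * of_real \<xi> * of_real x)
       * indicator \<Omega> x"

definition spectral_set :: "real set \<Rightarrow> bool" where
  "spectral_set \<Omega> \<longleftrightarrow>
     \<Omega> \<in> lmeasurable \<and> 0 < measure lebesgue \<Omega> \<and>
     (\<exists>\<Lambda>. L2_orthonormal_basis \<Omega> \<Lambda> (normalized_exponential \<Omega>))"

definition tiles_by_translations :: "real set \<Rightarrow> bool" where
  "tiles_by_translations \<Omega> \<longleftrightarrow>
     (\<exists>T. (\<forall>s\<in>T. \<forall>t\<in>T. s \<noteq> t \<longrightarrow> (+) s ` \<Omega> \<inter> (+) t ` \<Omega> \<in> null_sets lebesgue) \<and>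
          - (\<Union>t\<in>T. (+) t ` \<Omega>) \<in> null_sets lebesgue)"

end

theory Submission
  imports Defs
begin

text \<open>
  Write \<open>e(t) = exp (2 \<pi> \<i> t)\<close> and let \<open>\<alpha>, \<beta>, \<gamma>\<close> be the left endpoints of the three intervals.
  The Fourier transform of \<open>\<Omega>\<close> at \<open>\<xi>\<close> is, up to a unimodular factor, the transform \<open>J(\<xi>)\<close> of
  \<open>[0, 1/3]\<close> times \<open>1 + e(\<xi>(\<beta> - \<alpha>)) + e(\<xi>(\<gamma> - \<alpha>))\<close>. So the difference of two points of a spectrum
  \<open>\<Lambda>\<close> either lies in \<open>3\<int>\<close> or makes \<open>(1, e(\<xi>(\<beta> - \<alpha>)), e(\<xi>(\<gamma> - \<alpha>)))\<close> the triple of cube roots of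
  unity, in some order (\<open>difference_cases\<close>). Differences of the second kind are detected by a
  nontrivial cube root of unity that is multiplicative in \<open>\<xi>\<close>, hence \<open>\<Lambda>\<close> meets at most three
  classes modulo \<open>3\<int>\<close>.

  The main point is that \<open>\<Lambda>\<close> must be \<open>3\<int>\<close>-periodic. Expand
  \<open>e(\<mu> x)\<close>, restricted to the interval \<open>A\<close> alone, in the basis: Parseval gives
  \<open>\<Sum>\<^sub>\<lambda> \<bar>J(\<mu> - \<lambda>)\<bar>\<^sup>2 = 1/3\<close> for every real \<open>\<mu>\<close>. On the other hand exponentials from one class are
  orthogonal on \<open>A\<close>, so by Bessel each class contributes at most \<open>1/9\<close>. A number \<open>\<mu>\<close> missing from
  a class that does occur gets nothing from that class and at most \<open>2/9\<close> from the other two, which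
  is too little (\<open>spectrum_periodic\<close>). Likewise one class cannot suffice
  (\<open>spectrum_two_classes\<close>).

  Take \<open>\<sigma>\<close> to be a difference between two classes. By periodicity all \<open>\<sigma> + 3k\<close> are differences
  of the second kind, so \<open>e(3(\<beta> - \<alpha>))\<close> and \<open>e(3(\<gamma> - \<alpha>))\<close> are 1. Thus \<open>\<beta> - \<alpha> = m/3\<close> and \<open>\<gamma> - \<alpha> = n/3\<close> with
  integers \<open>m, n\<close>, and evaluation at \<open>\<sigma>\<close> shows that \<open>m/d\<close> and \<open>n/d\<close>, for \<open>d = gcd m n\<close>, are 1 and 2
  modulo 3 in some order (\<open>arithmetic_of_gaps\<close>, \<open>integer_tiling_of_triple\<close>). Hence \<open>{0, m, n}\<close>
  tiles the integers, and \<open>\<Omega>\<close>, a union of three cells of a grid of step \<open>1/3\<close>, tiles the line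
  (\<open>tiles_by_integer_tiling\<close>).
\<close>

section \<open>Bessel and Parseval for finite orthonormal families\<close>

lemma L2_prod_integrable:
  assumes f: "f \<in> L2_space \<Omega>" and g: "g \<in> L2_space \<Omega>"
  shows "integrable (lebesgue_on \<Omega>) (\<lambda>x. f x * cnj (g x))"
proof (rule Bochner_Integration.integrable_bound)
  have [measurable]: "f \<in> borel_measurable (lebesgue_on \<Omega>)" "g \<in> borel_measurable (lebesgue_on \<Omega>)"
    using f g by (auto simp: L2_space_def)
  show "integrable (lebesgue_on \<Omega>) (\<lambda>x. (cmod (f x))\<^sup>2 + (cmod (g x))\<^sup>2)"
    using f g by (auto simp: L2_space_def)
  have "(\<lambda>x. cnj (g x)) \<in> borel_measurable (lebesgue_on \<Omega>)"
    by (rule borel_measurable_continuous_on[of cnj]) (auto intro!: continuous_intros)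
  then show "(\<lambda>x. f x * cnj (g x)) \<in> borel_measurable (lebesgue_on \<Omega>)"
    by simp
  show "AE x in lebesgue_on \<Omega>. norm (f x * cnj (g x)) \<le> norm ((cmod (f x))\<^sup>2 + (cmod (g x))\<^sup>2)"
  proof (rule AE_I2)
    fix x
    have "2 * (cmod (f x) * cmod (g x)) \<le> (cmod (f x))\<^sup>2 + (cmod (g x))\<^sup>2"
      using sum_squares_bound[of "cmod (f x)" "cmod (g x)"] by simp
    moreover have "0 \<le> cmod (f x) * cmod (g x)" by simp
    ultimately show "norm (f x * cnj (g x)) \<le> norm ((cmod (f x))\<^sup>2 + (cmod (g x))\<^sup>2)"
      by (simp add: norm_mult del: mult_nonneg_nonneg)
  qed
qed

lemma L2_inner_self: "L2_inner \<Omega> f f = of_real ((L2_norm \<Omega> f)\<^sup>2)"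
proof -
  have "0 \<le> (LINT x|lebesgue_on \<Omega>. (cmod (f x))\<^sup>2)"
    by (rule Bochner_Integration.integral_nonneg) simp
  then show ?thesis
    by (simp add: L2_inner_def L2_norm_def complex_norm_square[symmetric] flip: of_real_power)
qed

lemma L2_inner_commute: "L2_inner \<Omega> g f = cnj (L2_inner \<Omega> f g)"
  by (simp add: L2_inner_def mult.commute flip: Bochner_Integration.integral_cnj)

text \<open>
  This one identity yields both inequalities below: choosing the Fourier coefficients for \<open>c\<close>
  gives Bessel, and for arbitrary \<open>c\<close> it says that they are the best choice, so that any good
  approximation forces the sum of the squared Fourier coefficients to be large.
\<close>

lemma L2_norm_diff_orthonormal:
  assumes F: "finite F" and f: "f \<in> L2_space \<Omega>" and e: "\<And>i. i \<in> F \<Longrightarrow> e i \<in> L2_space \<Omega>"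
    and on: "\<And>i j. i \<in> F \<Longrightarrow> j \<in> F \<Longrightarrow> L2_inner \<Omega> (e i) (e j) = (if i = j then 1 else 0)"
  shows "(L2_norm \<Omega> (\<lambda>x. f x - (\<Sum>i\<in>F. c i * e i x)))\<^sup>2 =
    (L2_norm \<Omega> f)\<^sup>2 - (\<Sum>i\<in>F. (cmod (L2_inner \<Omega> f (e i)))\<^sup>2)
      + (\<Sum>i\<in>F. (cmod (c i - L2_inner \<Omega> f (e i)))\<^sup>2)"
proof -
  define a where "a i = L2_inner \<Omega> f (e i)" for i
  let ?g = "\<lambda>x. f x - (\<Sum>i\<in>F. c i * e i x)"
  note [simp] = L2_prod_integrable[OF f f] L2_prod_integrable[OF f e] L2_prod_integrable[OF e f]
    L2_prod_integrable[OF e e]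
  have "L2_inner \<Omega> ?g ?g = (LINT x|lebesgue_on \<Omega>. f x * cnj (f x)
      - (\<Sum>i\<in>F. cnj (c i) * (f x * cnj (e i x))) - (\<Sum>i\<in>F. c i * (e i x * cnj (f x)))
      + (\<Sum>i\<in>F. \<Sum>j\<in>F. (c j * cnj (c i)) * (e j x * cnj (e i x))))"
    unfolding L2_inner_def
    by (rule Bochner_Integration.integral_cong)
       (simp_all add: algebra_simps sum_distrib_left sum_distrib_right)
  also have "\<dots> = L2_inner \<Omega> f f - (\<Sum>i\<in>F. cnj (c i) * a i) - (\<Sum>i\<in>F. c i * L2_inner \<Omega> (e i) f)
      + (\<Sum>i\<in>F. \<Sum>j\<in>F. (c j * cnj (c i)) * L2_inner \<Omega> (e j) (e i))"
    by (simp add: L2_inner_def a_def)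
  also have "(\<Sum>i\<in>F. \<Sum>j\<in>F. (c j * cnj (c i)) * L2_inner \<Omega> (e j) (e i)) = (\<Sum>i\<in>F. c i * cnj (c i))"
    using F by (intro sum.cong refl) (simp add: on if_distrib cong: if_cong)
  also have "(\<Sum>i\<in>F. c i * L2_inner \<Omega> (e i) f) = (\<Sum>i\<in>F. c i * cnj (a i))"
    by (simp add: a_def L2_inner_commute[of _ _ f])
  also have "L2_inner \<Omega> f f - (\<Sum>i\<in>F. cnj (c i) * a i) - (\<Sum>i\<in>F. c i * cnj (a i)) + (\<Sum>i\<in>F. c i * cnj (c i))
    = of_real ((L2_norm \<Omega> f)\<^sup>2) - (\<Sum>i\<in>F. of_real ((cmod (a i))\<^sup>2)) + (\<Sum>i\<in>F. of_real ((cmod (c i - a i))\<^sup>2))"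
    unfolding L2_inner_self complex_norm_square
    by (simp add: algebra_simps sum.distrib sum_subtractf)
  finally have "complex_of_real ((L2_norm \<Omega> ?g)\<^sup>2) = of_real ((L2_norm \<Omega> f)\<^sup>2
      - (\<Sum>i\<in>F. (cmod (a i))\<^sup>2) + (\<Sum>i\<in>F. (cmod (c i - a i))\<^sup>2))"
    by (simp add: L2_inner_self)
  then show ?thesis
    unfolding a_def of_real_eq_iff .
qed

lemma L2_Bessel:
  assumes "finite F" and "f \<in> L2_space \<Omega>" and "\<And>i. i \<in> F \<Longrightarrow> e i \<in> L2_space \<Omega>"
    and "\<And>i j. i \<in> F \<Longrightarrow> j \<in> F \<Longrightarrow> L2_inner \<Omega> (e i) (e j) = (if i = j then 1 else 0)"
  shows "(\<Sum>i\<in>F. (cmod (L2_inner \<Omega> f (e i)))\<^sup>2) \<le> (L2_norm \<Omega> f)\<^sup>2"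
  using L2_norm_diff_orthonormal[OF assms, where c = "\<lambda>i. L2_inner \<Omega> f (e i)"]
    zero_le_power2[of "L2_norm \<Omega> (\<lambda>x. f x - (\<Sum>i\<in>F. L2_inner \<Omega> f (e i) * e i x))"]
  by simp

lemma L2_Parseval_approx:
  assumes basis: "L2_orthonormal_basis \<Omega> I e" and f: "f \<in> L2_space \<Omega>" and "\<epsilon> > 0"
  obtains F where "finite F" "F \<subseteq> I"
    "(L2_norm \<Omega> f)\<^sup>2 - \<epsilon> < (\<Sum>i\<in>F. (cmod (L2_inner \<Omega> f (e i)))\<^sup>2)"
proof -
  obtain F c where F: "finite F" "F \<subseteq> I" and
    *: "L2_norm \<Omega> (\<lambda>x. f x - (\<Sum>i\<in>F. c i * e i x)) < sqrt \<epsilon>"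
    using basis f \<open>\<epsilon> > 0\<close> unfolding L2_orthonormal_basis_def by (meson real_sqrt_gt_zero)
  have "0 \<le> L2_norm \<Omega> (\<lambda>x. f x - (\<Sum>i\<in>F. c i * e i x))"
    unfolding L2_norm_def by (intro real_sqrt_ge_zero Bochner_Integration.integral_nonneg) simp
  with * \<open>\<epsilon> > 0\<close> have "(L2_norm \<Omega> (\<lambda>x. f x - (\<Sum>i\<in>F. c i * e i x)))\<^sup>2 < \<epsilon>"
    using power_strict_mono[OF *, of 2] by simp
  moreover have "(L2_norm \<Omega> (\<lambda>x. f x - (\<Sum>i\<in>F. c i * e i x)))\<^sup>2 =
    (L2_norm \<Omega> f)\<^sup>2 - (\<Sum>i\<in>F. (cmod (L2_inner \<Omega> f (e i)))\<^sup>2)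
      + (\<Sum>i\<in>F. (cmod (c i - L2_inner \<Omega> f (e i)))\<^sup>2)"
    using basis F unfolding L2_orthonormal_basis_def by (intro L2_norm_diff_orthonormal f) (simp_all add: subset_iff)
  moreover have "0 \<le> (\<Sum>i\<in>F. (cmod (c i - L2_inner \<Omega> f (e i)))\<^sup>2)"
    by (intro sum_nonneg) simp
  ultimately show ?thesis using F that by fastforce
qed

section \<open>Exponentials on an interval\<close>

definition wave :: "real \<Rightarrow> real \<Rightarrow> complex" where
  "wave \<xi> x = cis (2 * pi * (\<xi> * x))"

text \<open>
  The Fourier transform of the indicator of \<open>[0, L]\<close>, with the sign of the frequency reversed.
\<close>

definition box_transform :: "real \<Rightarrow> real \<Rightarrow> complex" where
  "box_transform L \<xi> = integral {0..L} (wave \<xi>)"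

lemma wave_diff_left: "wave (\<xi> - \<eta>) x = wave \<xi> x * cnj (wave \<eta> x)"
  by (simp add: wave_def cis_cnj cis_mult algebra_simps)

lemma wave_add_left: "wave (\<xi> + \<eta>) x = wave \<xi> x * wave \<eta> x"
  by (simp add: wave_def cis_mult algebra_simps)

lemma wave_add_right: "wave \<xi> (x + y) = wave \<xi> x * wave \<xi> y"
  by (simp add: wave_def cis_mult algebra_simps)

lemma norm_wave [simp]: "cmod (wave \<xi> x) = 1"
  by (simp add: wave_def)

lemma wave_nonzero [simp]: "wave \<xi> x \<noteq> 0"
  by (simp add: wave_def)

lemma wave_eq_1_iff: "wave \<xi> x = 1 \<longleftrightarrow> \<xi> * x \<in> \<int>"
proof -
  have "wave \<xi> x = 1 \<longleftrightarrow> (\<exists>n::int. 2 * pi * (\<xi> * x) = of_int (2 * n) * pi)"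
    unfolding wave_def cis_conv_exp exp_eq_1 by simp
  also have "\<dots> \<longleftrightarrow> (\<exists>n::int. \<xi> * x = of_int n)" by auto
  finally show ?thesis by (auto simp: Ints_def)
qed

lemma continuous_on_wave: "continuous_on S (wave \<xi>)"
  unfolding wave_def by (intro continuous_intros)

text \<open>
  Translating the interval only changes the phase of the integral.
\<close>

lemma wave_has_integral_Icc:
  assumes "L \<ge> 0"
  shows "(wave \<xi> has_integral wave \<xi> \<alpha> * box_transform L \<xi>) {\<alpha>..\<alpha> + L}"
proof -
  have "(wave \<xi> has_integral box_transform L \<xi>) (cbox 0 L)"
    unfolding box_transform_def cbox_interval
    by (intro integrable_integral integrable_continuous_interval continuous_on_wave)
  from has_integral_affinity[OF this, of 1 "-\<alpha>"] assms
  have "((\<lambda>x. wave \<xi> (x - \<alpha>)) has_integral box_transform L \<xi>) {\<alpha>..\<alpha> + L}"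
    by (simp add: add.commute)
  then have "((\<lambda>x. wave \<xi> \<alpha> * wave \<xi> (x - \<alpha>)) has_integral wave \<xi> \<alpha> * box_transform L \<xi>) {\<alpha>..\<alpha> + L}"
    by (rule has_integral_mult_right)
  then show ?thesis by (simp flip: wave_add_right)
qed

lemma box_transform_0: "L \<ge> 0 \<Longrightarrow> box_transform L 0 = of_real L"
  by (simp add: box_transform_def wave_def[abs_def] scaleR_conv_of_real)

lemma box_transform_eq_0_iff:
  assumes "L > 0"
  shows "box_transform L \<xi> = 0 \<longleftrightarrow> \<xi> \<noteq> 0 \<and> \<xi> * L \<in> \<int>"
proof (cases "\<xi> = 0")
  case True
  then show ?thesis using assms by (simp add: box_transform_0)
next
  case False
  let ?k = "2 * of_real pi * \<i> * of_real \<xi> :: complex"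
  have "(wave \<xi> has_integral wave \<xi> L / ?k - wave \<xi> 0 / ?k) {0..L}"
  proof (rule fundamental_theorem_of_calculus)
    fix x
    have "((\<lambda>z. exp (?k * z) / ?k) has_field_derivative wave \<xi> x) (at (of_real x))"
      using False by (auto intro!: derivative_eq_intros simp: wave_def cis_conv_exp mult_ac)
    then have "((\<lambda>t. exp (?k * of_real t) / ?k) has_vector_derivative wave \<xi> x) (at x within {0..L})"
      by (rule has_vector_derivative_real_field)
    then show "((\<lambda>t. wave \<xi> t / ?k) has_vector_derivative wave \<xi> x) (at x within {0..L})"
      by (simp add: wave_def cis_conv_exp mult_ac)
  qed (use assms in simp)
  then have "box_transform L \<xi> = (wave \<xi> L - 1) / ?k"
    unfolding box_transform_def by (simp add: integral_unique wave_def[of _ 0] diff_divide_distrib)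
  then show ?thesis using False by (simp add: wave_eq_1_iff)
qed

text \<open>
  The four kinds of bounded intervals differ only in endpoints, which no integral sees; all of
  them are handled at once.
\<close>

definition segment_at :: "real \<Rightarrow> real \<Rightarrow> real set \<Rightarrow> bool" where
  "segment_at L \<alpha> A \<longleftrightarrow> {\<alpha><..<\<alpha> + L} \<subseteq> A \<and> A \<subseteq> {\<alpha>..\<alpha> + L}"

lemma segment_lmeasurable:
  assumes "segment_at L \<alpha> A"
  shows "A \<in> lmeasurable"
proof -
  have "A - {\<alpha><..<\<alpha> + L} \<subseteq> {\<alpha>, \<alpha> + L}"
    using assms unfolding segment_at_def by fastforce
  then have "A - {\<alpha><..<\<alpha> + L} \<in> lmeasurable"
    by (rule negligible_imp_measurable[OF negligible_subset[OF negligible_finite, rotated]]) simp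
  then have "(A - {\<alpha><..<\<alpha> + L}) \<union> {\<alpha><..<\<alpha> + L} \<in> lmeasurable"
    by (intro fmeasurable.Un) auto
  moreover have "(A - {\<alpha><..<\<alpha> + L}) \<union> {\<alpha><..<\<alpha> + L} = A"
    using assms unfolding segment_at_def by blast
  ultimately show ?thesis by metis
qed

lemma segment_at_of_interval:
  fixes A :: "real set"
  assumes A: "is_interval A" and m: "measure lebesgue A > 0"
  obtains \<alpha> where "segment_at (measure lebesgue A) \<alpha> A"
proof -
  let ?L = "measure lebesgue A"
  \<comment> \<open>\<open>measure\<close> is 0 on non-measurable sets and on sets of infinite measure.\<close>
  have lm: "A \<in> lmeasurable"
  proof (rule fmeasurableI)
    show "A \<in> sets lebesgue" using m measure_notin_sets[of A lebesgue] by auto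
    have "emeasure lebesgue A \<noteq> top"
    proof
      assume "emeasure lebesgue A = top"
      then have "?L = 0" by (simp add: measure_def)
      with m show False by simp
    qed
    then show "emeasure lebesgue A < \<infinity>"
      unfolding less_top infinity_ennreal_def .
  qed
  have diam: "y - x \<le> ?L" if "x \<in> A" "y \<in> A" for x y
  proof (cases "x \<le> y")
    case True
    have "{x..y} \<subseteq> A" using mem_is_interval_1_I[OF A that] by fastforce
    then have "measure lebesgue {x..y} \<le> ?L" by (intro measure_mono_fmeasurable lm) auto
    then show ?thesis using True by simp
  next
    case False
    then show ?thesis using m by linarith
  qed
  have ne: "A \<noteq> {}" using m by auto
  then obtain a where a: "a \<in> A" by auto
  have bdd: "bdd_below A" "bdd_above A"
  proof -
    have *: "a - ?L \<le> x" "x \<le> a + ?L" if "x \<in> A" for x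
      using diam[OF a that] diam[OF that a] by linarith+
    show "bdd_below A" by (rule bdd_belowI) (rule *)
    show "bdd_above A" by (rule bdd_aboveI) (rule *)
  qed
  have sub: "A \<subseteq> {Inf A..Sup A}"
    using cInf_lower[OF _ bdd(1)] cSup_upper[OF _ bdd(2)] by auto
  have sup: "{Inf A<..<Sup A} \<subseteq> A"
  proof
    fix x assume x: "x \<in> {Inf A<..<Sup A}"
    then obtain u where u: "u \<in> A" "u < x"
      using cInf_lessD[OF ne, of x] by auto
    obtain v where v: "v \<in> A" "x < v"
      using less_cSupE[OF _ ne, of x] x by auto
    show "x \<in> A" using mem_is_interval_1_I[OF A u(1) v(1)] u v by simp
  qed
  have "Inf A \<le> Sup A" using sub a by auto
  moreover have "?L \<le> measure lebesgue {Inf A..Sup A}"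
    by (intro measure_mono_fmeasurable sub) (use lm in auto)
  moreover have "measure lebesgue {Inf A<..<Sup A} \<le> ?L"
    by (intro measure_mono_fmeasurable sup lm) auto
  ultimately have "?L = Sup A - Inf A" by simp
  then show ?thesis using that[of "Inf A"] sub sup by (simp add: segment_at_def)
qed

lemma wave_has_integral_segment:
  assumes "segment_at L \<alpha> A" and "L \<ge> 0"
  shows "(wave \<xi> has_integral wave \<xi> \<alpha> * box_transform L \<xi>) A"
proof -
  have "x \<in> A \<longleftrightarrow> x \<in> {\<alpha>..\<alpha> + L}" if "x \<notin> {\<alpha>, \<alpha> + L}" for x
    using assms(1) that unfolding segment_at_def by fastforce
  then have sub: "{x \<in> A - {\<alpha>..\<alpha> + L}. wave \<xi> x \<noteq> 0} \<subseteq> {\<alpha>, \<alpha> + L}"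
    "{x \<in> {\<alpha>..\<alpha> + L} - A. wave \<xi> x \<noteq> 0} \<subseteq> {\<alpha>, \<alpha> + L}"
    by blast+
  have "(wave \<xi> has_integral I) A \<longleftrightarrow> (wave \<xi> has_integral I) {\<alpha>..\<alpha> + L}" for I
    by (intro has_integral_spike_set_eq negligible_subset[OF negligible_finite sub(1)]
        negligible_subset[OF negligible_finite sub(2)]) simp_all
  then show ?thesis
    using wave_has_integral_Icc[OF assms(2)] by simp
qed

lemma wave_integrable:
  assumes "S \<in> lmeasurable"
  shows "integrable (lebesgue_on S) (wave \<xi>)"
proof (rule measurable_bounded_by_integrable_imp_lebesgue_integrable)
  show "wave \<xi> \<in> borel_measurable (lebesgue_on S)"
    using continuous_on_wave assms by (intro continuous_imp_measurable_on_sets_lebesgue) auto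
  show "integrable (lebesgue_on S) (\<lambda>x. 1::real)"
    using assms by (intro finite_measure.integrable_const finite_measure_lebesgue_on)
qed (use assms in auto)

lemma wave_in_L2:
  assumes "S \<in> lmeasurable"
  shows "wave \<xi> \<in> L2_space S"
  using wave_integrable[OF assms, of \<xi>] wave_integrable[OF assms, of 0]
    integrable_norm[OF wave_integrable[OF assms, of 0]]
  by (auto simp: L2_space_def)

lemma L2_inner_wave:
  assumes "S \<in> lmeasurable" and "(wave (\<xi> - \<eta>) has_integral I) S"
  shows "L2_inner S (wave \<xi>) (wave \<eta>) = I"
proof -
  have "L2_inner S (wave \<xi>) (wave \<eta>) = integral\<^sup>L (lebesgue_on S) (wave (\<xi> - \<eta>))"
    by (simp add: L2_inner_def wave_diff_left[abs_def])
  also have "\<dots> = integral S (wave (\<xi> - \<eta>))"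
    using assms(1) by (intro lebesgue_integral_eq_integral wave_integrable) auto
  finally show ?thesis using assms(2) by (simp add: integral_unique)
qed

lemma L2_inner_cut:
  assumes "A \<subseteq> \<Omega>" and "A \<in> sets lebesgue" and "\<Omega> \<in> sets lebesgue"
  shows "L2_inner \<Omega> (\<lambda>x. f x * indicator A x) g = L2_inner A f g"
proof -
  have "indicator \<Omega> x *\<^sub>R (f x * indicator A x * cnj (g x)) = indicator A x *\<^sub>R (f x * cnj (g x))" for x
    using assms(1) by (auto simp: indicator_def)
  then show ?thesis
    using assms by (simp add: L2_inner_def integral_restrict_space)
qed

lemma L2_cut:
  assumes "A \<subseteq> \<Omega>" and "A \<in> sets lebesgue" and "\<Omega> \<in> sets lebesgue" and f: "f \<in> L2_space \<Omega>"
  shows "(\<lambda>x. f x * indicator A x) \<in> L2_space \<Omega>"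
proof -
  have A: "A \<in> sets (lebesgue_on \<Omega>)"
    using assms by (simp add: sets_restrict_space_iff)
  have eq: "(cmod (f x * indicator A x))\<^sup>2 = (cmod (f x))\<^sup>2 * indicator A x" for x
    by (simp add: indicator_def)
  have [measurable]: "f \<in> borel_measurable (lebesgue_on \<Omega>)" and
    int: "integrable (lebesgue_on \<Omega>) (\<lambda>x. (cmod (f x))\<^sup>2)"
    using f by (auto simp: L2_space_def)
  have "(\<lambda>x. f x * indicator A x) \<in> borel_measurable (lebesgue_on \<Omega>)"
    using A by measurable
  moreover have "integrable (lebesgue_on \<Omega>) (\<lambda>x. (cmod (f x))\<^sup>2 * indicator A x)"
    using integrable_mult_indicator[OF A int] by (simp add: mult.commute)
  ultimately show ?thesis unfolding L2_space_def mem_Collect_eq eq by blast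
qed

text \<open>
  Frequencies that differ by multiples of \<open>1/L\<close> are orthogonal on \<open>[0, L]\<close>, so this is Bessel's
  inequality for \<open>wave \<mu>\<close> and the normalized exponentials \<open>wave \<kappa> / sqrt L\<close>.
\<close>

lemma wave_Bessel:
  assumes L: "L > 0" and F: "finite F"
    and sep: "\<And>\<kappa> \<nu>. \<kappa> \<in> F \<Longrightarrow> \<nu> \<in> F \<Longrightarrow> (\<kappa> - \<nu>) * L \<in> \<int>"
  shows "(\<Sum>\<kappa>\<in>F. (cmod (box_transform L (\<mu> - \<kappa>)))\<^sup>2) \<le> L\<^sup>2"
proof -
  let ?S = "{0..L}"
  define e where "e \<kappa> x = of_real (1 / sqrt L) * wave \<kappa> x" for \<kappa> x
  have S: "?S \<in> lmeasurable" by simp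
  have inner: "L2_inner ?S (wave \<xi>) (wave \<eta>) = box_transform L (\<xi> - \<eta>)" for \<xi> \<eta>
    using wave_has_integral_Icc[of L "\<xi> - \<eta>" 0] L
    by (intro L2_inner_wave S) (simp add: wave_def[of _ 0])
  have e_L2: "e \<kappa> \<in> L2_space ?S" for \<kappa>
    using wave_in_L2[OF S, of \<kappa>] finite_measure.integrable_const[OF finite_measure_lebesgue_on[OF S]]
    by (auto simp: L2_space_def e_def[abs_def] norm_divide power_divide)
  have e1: "L2_inner ?S f (e \<kappa>) = of_real (1 / sqrt L) * L2_inner ?S f (wave \<kappa>)" for f \<kappa>
  proof -
    have "(\<lambda>x. f x * cnj (e \<kappa> x)) = (\<lambda>x. of_real (1 / sqrt L) * (f x * cnj (wave \<kappa> x)))"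
      by (simp add: e_def mult_ac)
    then show ?thesis unfolding L2_inner_def by (simp only: integral_mult_right_zero)
  qed
  have e2: "L2_inner ?S (e \<kappa>) f = of_real (1 / sqrt L) * L2_inner ?S (wave \<kappa>) f" for f \<kappa>
    using e1[of f \<kappa>] by (simp add: L2_inner_commute[of _ "e \<kappa>"] L2_inner_commute[of _ "wave \<kappa>" f])
  have sq: "complex_of_real (sqrt L) * of_real (sqrt L) = of_real L"
    using L by (simp flip: of_real_mult)
  have on: "L2_inner ?S (e \<kappa>) (e \<nu>) = (if \<kappa> = \<nu> then 1 else 0)" if "\<kappa> \<in> F" "\<nu> \<in> F" for \<kappa> \<nu>
  proof (cases "\<kappa> = \<nu>")
    case True
    then show ?thesis using L sq by (simp add: e1 e2 inner box_transform_0)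
  next
    case False
    then have "box_transform L (\<kappa> - \<nu>) = 0"
      using box_transform_eq_0_iff[OF L] sep[OF that] by simp
    with False show ?thesis by (simp add: e1 e2 inner)
  qed
  have "complex_of_real ((L2_norm ?S (wave \<mu>))\<^sup>2) = of_real L"
    using L by (simp add: inner box_transform_0 del: of_real_power flip: L2_inner_self)
  then have norm: "(L2_norm ?S (wave \<mu>))\<^sup>2 = L" unfolding of_real_eq_iff .
  have "(\<Sum>\<kappa>\<in>F. (cmod (L2_inner ?S (wave \<mu>) (e \<kappa>)))\<^sup>2) \<le> L"
    using L2_Bessel[OF F wave_in_L2[OF S, of \<mu>] e_L2 on] norm by simp
  moreover have "(cmod (L2_inner ?S (wave \<mu>) (e \<kappa>)))\<^sup>2 = (cmod (box_transform L (\<mu> - \<kappa>)))\<^sup>2 / L" for \<kappa>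
    using L by (simp add: e1 inner norm_divide power_divide)
  ultimately show ?thesis
    using L by (simp add: sum_divide_distrib[symmetric] divide_le_eq power2_eq_square)
qed

lemma normalized_exponential_wave:
  assumes "measure lebesgue \<Omega> = 1" and "L2_orthonormal_basis \<Omega> \<Lambda> (normalized_exponential \<Omega>)"
  shows "L2_orthonormal_basis \<Omega> \<Lambda> wave"
proof -
  have eq: "normalized_exponential \<Omega> \<xi> x = wave \<xi> x" if "x \<in> \<Omega>" for \<xi> x
    using that assms(1) by (simp add: normalized_exponential_def wave_def cis_conv_exp mult_ac)
  have sp: "x \<in> \<Omega>" if "x \<in> space (lebesgue_on \<Omega>)" for x
    using that by simp
  have "normalized_exponential \<Omega> i \<in> L2_space \<Omega> \<longleftrightarrow> wave i \<in> L2_space \<Omega>" for i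
  proof -
    have "normalized_exponential \<Omega> i \<in> borel_measurable (lebesgue_on \<Omega>) \<longleftrightarrow> wave i \<in> borel_measurable (lebesgue_on \<Omega>)"
      by (intro measurable_cong eq sp)
    moreover have "integrable (lebesgue_on \<Omega>) (\<lambda>x. (cmod (normalized_exponential \<Omega> i x))\<^sup>2) \<longleftrightarrow>
      integrable (lebesgue_on \<Omega>) (\<lambda>x. (cmod (wave i x))\<^sup>2)"
      by (intro Bochner_Integration.integrable_cong) (simp_all add: eq)
    ultimately show ?thesis by (simp add: L2_space_def)
  qed
  moreover have "L2_inner \<Omega> (normalized_exponential \<Omega> i) (normalized_exponential \<Omega> j)
      = L2_inner \<Omega> (wave i) (wave j)" for i j
    unfolding L2_inner_def by (intro Bochner_Integration.integral_cong) (simp_all add: eq)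
  moreover have "L2_norm \<Omega> (\<lambda>x. f x - (\<Sum>i\<in>F. c i * normalized_exponential \<Omega> i x))
      = L2_norm \<Omega> (\<lambda>x. f x - (\<Sum>i\<in>F. c i * wave i x))" for f F c
    unfolding L2_norm_def by (intro arg_cong[where f = sqrt] Bochner_Integration.integral_cong) (simp_all add: eq)
  ultimately show ?thesis using assms(2) by (simp add: L2_orthonormal_basis_def)
qed

section \<open>Vanishing sums and progressions of cube roots of unity\<close>

text \<open>
  Since \<open>w = - (1 + z)\<close> is unimodular, \<open>z + cnj z = -1\<close>; multiplying by \<open>z\<close> turns this into the
  equation of the primitive cube roots of unity.
\<close>

lemma sum_unit_complex_eq_0:
  fixes z w :: complex
  assumes "1 + z + w = 0" and "cmod z = 1" and "cmod w = 1"
  shows "z ^ 3 = 1" and "z \<noteq> 1" and "w = z\<^sup>2"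
proof -
  have w: "w = - (1 + z)" using add.inverse_unique[OF assms(1)] by simp
  have z: "z * cnj z = 1" and "w * cnj w = 1"
    using assms(2,3) by (simp_all flip: complex_norm_square)
  then have "1 + z + cnj z = 0"
    unfolding w by (simp add: algebra_simps)
  then have "z * (1 + z + cnj z) = 0" by simp
  then have q: "1 + z + z\<^sup>2 = 0" using z by (simp add: algebra_simps power2_eq_square)
  have "z ^ 3 - 1 = (z - 1) * (1 + z + z\<^sup>2)" by (simp add: algebra_simps power2_eq_square power3_eq_cube)
  then show "z ^ 3 = 1" using q by simp
  show "z \<noteq> 1" using q by auto
  show "w = z\<^sup>2" using q assms(1) by (metis add_left_cancel)
qed

text \<open>
  The quotient \<open>u\<close> is itself a cube root of unity; a nontrivial one would carry \<open>z\<close> to 1 within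
  two steps.
\<close>

lemma cube_roots_progression:
  fixes z u :: complex
  assumes "z ^ 3 = 1" "z \<noteq> 1" "(z * u) ^ 3 = 1" "z * u \<noteq> 1" "z * u * u \<noteq> 1"
  shows "u = 1"
proof (rule ccontr)
  assume u: "u \<noteq> 1"
  have q: "1 + x + x\<^sup>2 = 0" if "x ^ 3 = 1" "x \<noteq> 1" for x :: complex
  proof -
    have "(x - 1) * (1 + x + x\<^sup>2) = x ^ 3 - 1" by (simp add: algebra_simps power2_eq_square power3_eq_cube)
    with that show ?thesis by simp
  qed
  have "u ^ 3 = 1" using assms(1,3) by (simp add: power_mult_distrib)
  then have "1 + u + u\<^sup>2 = 0" using q u by blast
  moreover have "z + z\<^sup>2 = - 1" using q[OF assms(1,2)] by (simp add: eq_neg_iff_add_eq_0 ac_simps)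
  moreover have "(u - z) * (u - z\<^sup>2) = u\<^sup>2 - (z + z\<^sup>2) * u + z ^ 3"
    by (simp add: algebra_simps power2_eq_square power3_eq_cube)
  ultimately have "(u - z) * (u - z\<^sup>2) = 0" using assms(1) by (simp add: ac_simps)
  then have "u = z \<or> u = z\<^sup>2" by simp
  moreover have "z * z * z = 1" using assms(1) by (simp add: power3_eq_cube)
  ultimately show False using assms(4,5) by (elim disjE) (simp_all add: power2_eq_square mult.assoc)
qed

section \<open>The spectrum of three intervals\<close>

locale spectral_triple =
  fixes \<alpha> \<beta> \<gamma> :: real and A B C :: "real set" and \<Lambda> :: "real set"
  assumes seg: "segment_at (1/3) \<alpha> A" "segment_at (1/3) \<beta> B" "segment_at (1/3) \<gamma> C"
    and disj: "A \<inter> B = {}" "A \<inter> C = {}" "B \<inter> C = {}"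
    and basis: "L2_orthonormal_basis (A \<union> B \<union> C) \<Lambda> wave"
begin

abbreviation "\<Omega> \<equiv> A \<union> B \<union> C"
abbreviation "J \<equiv> box_transform (1/3)"

lemma lmeasurable: "A \<in> lmeasurable" "\<Omega> \<in> lmeasurable"
  using seg[THEN segment_lmeasurable] by (auto intro!: fmeasurable.Un)

lemma J_eq_0: "J \<xi> = 0 \<longleftrightarrow> \<xi> \<noteq> 0 \<and> \<xi> / 3 \<in> \<int>"
  using box_transform_eq_0_iff[of "1/3" \<xi>] by simp

text \<open>
  The inner product of two exponentials over \<open>\<Omega>\<close> is \<open>J\<close> times a sum of three phases. As \<open>J\<close> does
  not vanish off \<open>3\<int>\<close>, orthogonality makes the phases cancel, which three unimodular numbers do
  only as multiples of the cube roots of unity.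
\<close>

lemma difference_cases:
  assumes "\<kappa> \<in> \<Lambda>" "\<mu> \<in> \<Lambda>" and nZ: "(\<kappa> - \<mu>) / 3 \<notin> \<int>"
  shows "wave (\<kappa> - \<mu>) (\<beta> - \<alpha>) ^ 3 = 1" "wave (\<kappa> - \<mu>) (\<beta> - \<alpha>) \<noteq> 1"
    "wave (\<kappa> - \<mu>) (\<gamma> - \<alpha>) = (wave (\<kappa> - \<mu>) (\<beta> - \<alpha>))\<^sup>2"
proof -
  let ?\<xi> = "\<kappa> - \<mu>"
  have "(wave ?\<xi> has_integral wave ?\<xi> \<alpha> * J ?\<xi> + wave ?\<xi> \<beta> * J ?\<xi> + wave ?\<xi> \<gamma> * J ?\<xi>) \<Omega>"
    using disj by (intro has_integral_Un wave_has_integral_segment seg) (auto simp: Int_Un_distrib2)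
  then have "L2_inner \<Omega> (wave \<kappa>) (wave \<mu>)
      = wave ?\<xi> \<alpha> * J ?\<xi> + wave ?\<xi> \<beta> * J ?\<xi> + wave ?\<xi> \<gamma> * J ?\<xi>"
    by (intro L2_inner_wave lmeasurable)
  moreover have "\<kappa> \<noteq> \<mu>" using nZ by auto
  ultimately have "(wave ?\<xi> \<alpha> + wave ?\<xi> \<beta> + wave ?\<xi> \<gamma>) * J ?\<xi> = 0"
    using basis assms unfolding L2_orthonormal_basis_def by (simp add: distrib_right)
  moreover have "J ?\<xi> \<noteq> 0" using nZ by (simp add: J_eq_0)
  ultimately have "wave ?\<xi> \<alpha> * (1 + wave ?\<xi> (\<beta> - \<alpha>) + wave ?\<xi> (\<gamma> - \<alpha>)) = 0"
    by (simp add: distrib_left flip: wave_add_right)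
  moreover have "wave ?\<xi> \<alpha> \<noteq> 0" by simp
  ultimately have "1 + wave ?\<xi> (\<beta> - \<alpha>) + wave ?\<xi> (\<gamma> - \<alpha>) = 0" by simp
  from sum_unit_complex_eq_0[OF this] show
    "wave (\<kappa> - \<mu>) (\<beta> - \<alpha>) ^ 3 = 1" "wave (\<kappa> - \<mu>) (\<beta> - \<alpha>) \<noteq> 1"
    "wave (\<kappa> - \<mu>) (\<gamma> - \<alpha>) = (wave (\<kappa> - \<mu>) (\<beta> - \<alpha>))\<^sup>2"
    by simp_all
qed

text \<open>
  The squared norm of \<open>wave \<mu>\<close> cut off to \<open>A\<close> is \<open>1/3\<close>. The bound \<open>2/9\<close> leaves room for the
  approximation error and is exactly what two classes modulo 3 can provide.
\<close>

lemma Parseval_on_A: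
  obtains F where "finite F" "F \<subseteq> \<Lambda>" "2/9 < (\<Sum>\<kappa>\<in>F. (cmod (J (\<mu> - \<kappa>)))\<^sup>2)"
proof -
  define f where "f x = wave \<mu> x * indicator A x" for x
  have A: "A \<subseteq> \<Omega>" "A \<in> sets lebesgue" "\<Omega> \<in> sets lebesgue"
    using lmeasurable by auto
  have f_L2: "f \<in> L2_space \<Omega>"
    unfolding f_def[abs_def] by (intro L2_cut A wave_in_L2 lmeasurable)
  have inner: "L2_inner A (wave \<xi>) (wave \<eta>) = wave (\<xi> - \<eta>) \<alpha> * J (\<xi> - \<eta>)" for \<xi> \<eta>
    by (intro L2_inner_wave lmeasurable wave_has_integral_segment seg) simp
  have cut: "L2_inner \<Omega> f g = L2_inner A (wave \<mu>) g" for g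
    unfolding f_def[abs_def] by (rule L2_inner_cut[OF A])
  have "L2_inner \<Omega> f f = L2_inner A (wave \<mu>) f" by (rule cut)
  also have "\<dots> = L2_inner A (wave \<mu>) (wave \<mu>)"
    unfolding L2_inner_def by (rule Bochner_Integration.integral_cong) (auto simp: f_def)
  also have "\<dots> = of_real (1/3)"
    using box_transform_0[of "1/3"] by (simp add: inner wave_def[of 0])
  finally have norm: "(L2_norm \<Omega> f)\<^sup>2 = 1/3"
    unfolding L2_inner_self of_real_eq_iff .
  obtain F where "finite F" "F \<subseteq> \<Lambda>"
    "(L2_norm \<Omega> f)\<^sup>2 - 1/9 < (\<Sum>\<kappa>\<in>F. (cmod (L2_inner \<Omega> f (wave \<kappa>)))\<^sup>2)"
    using L2_Parseval_approx[OF basis f_L2, of "1/9"] by auto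
  then show ?thesis
    using that by (simp add: norm cut inner norm_mult)
qed

lemma Bessel_class:
  assumes "finite F" and "\<And>\<kappa> \<nu>. \<kappa> \<in> F \<Longrightarrow> \<nu> \<in> F \<Longrightarrow> (\<kappa> - \<nu>) / 3 \<in> \<int>"
  shows "(\<Sum>\<kappa>\<in>F. (cmod (J (\<mu> - \<kappa>)))\<^sup>2) \<le> 1/9"
  using wave_Bessel[of "1/3" F \<mu>] assms by (simp add: power2_eq_square)

text \<open>
  If \<open>\<mu> = \<kappa> + 3 n\<close> were missing, the class of \<open>\<kappa>\<close> would contribute nothing to the Parseval sum at
  \<open>\<mu>\<close>, as \<open>J\<close> vanishes at nonzero multiples of 3, and the at most two other classes contribute at
  most \<open>2/9\<close>.
\<close>

lemma spectrum_periodic: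
  assumes \<kappa>: "\<kappa> \<in> \<Lambda>"
  shows "\<kappa> + 3 * of_int n \<in> \<Lambda>"
proof (rule ccontr)
  let ?\<mu> = "\<kappa> + 3 * of_int n"
  assume \<mu>: "?\<mu> \<notin> \<Lambda>"
  \<comment> \<open>The values of \<open>h\<close> label the classes of \<open>\<Lambda>\<close> modulo 3. The class of \<open>\<kappa>\<close> is set apart, since
    on differences in \<open>3\<int>\<close> the exponential need not be a cube root of unity.\<close>
  define h where "h \<nu> = (if (\<nu> - \<kappa>) / 3 \<in> \<int> then 1 else wave (\<nu> - \<kappa>) (\<beta> - \<alpha>))" for \<nu>
  let ?R = "{z::complex. z ^ 3 = 1}"
  have R: "finite ?R" "card ?R \<le> 3"
    using finite_roots_unity[of 3] card_roots_unity[of 3] by auto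
  have h_R: "h \<nu> \<in> ?R" if "\<nu> \<in> \<Lambda>" for \<nu>
    using difference_cases[OF that \<kappa>] by (auto simp: h_def)
  have h_eq: "(\<nu> - \<tau>) / 3 \<in> \<int>" if \<nu>: "\<nu> \<in> \<Lambda>" and \<tau>: "\<tau> \<in> \<Lambda>" and eq: "h \<nu> = h \<tau>" for \<nu> \<tau>
  proof (rule ccontr)
    assume no: "(\<nu> - \<tau>) / 3 \<notin> \<int>"
    have iff1: "h x = 1 \<longleftrightarrow> (x - \<kappa>) / 3 \<in> \<int>" if "x \<in> \<Lambda>" for x
      using difference_cases(2)[OF that \<kappa>] by (auto simp: h_def)
    show False
    proof (cases "h \<nu> = 1")
      case True
      then have "(\<nu> - \<kappa>) / 3 - (\<tau> - \<kappa>) / 3 \<in> \<int>"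
        using iff1[OF \<nu>] iff1[OF \<tau>] eq by (intro Ints_diff) simp_all
      then show False using no by (simp flip: diff_divide_distrib)
    next
      case False
      then have "(\<nu> - \<kappa>) / 3 \<notin> \<int>" "(\<tau> - \<kappa>) / 3 \<notin> \<int>"
        using iff1[OF \<nu>] iff1[OF \<tau>] eq by simp_all
      then have "wave (\<nu> - \<kappa>) (\<beta> - \<alpha>) = wave (\<tau> - \<kappa>) (\<beta> - \<alpha>)"
        using eq by (simp add: h_def)
      then have "wave (\<tau> - \<kappa>) (\<beta> - \<alpha>) * wave (\<nu> - \<tau>) (\<beta> - \<alpha>) = wave (\<tau> - \<kappa>) (\<beta> - \<alpha>)"
        by (simp flip: wave_add_left)
      moreover have "wave (\<tau> - \<kappa>) (\<beta> - \<alpha>) \<noteq> 0" by simp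
      ultimately show False using difference_cases(2)[OF \<nu> \<tau> no] by simp
    qed
  qed
  obtain F where F: "finite F" "F \<subseteq> \<Lambda>" and big: "2/9 < (\<Sum>\<nu>\<in>F. (cmod (J (?\<mu> - \<nu>)))\<^sup>2)"
    by (rule Parseval_on_A)
  define s where "s r = (\<Sum>\<nu>\<in>{\<nu>\<in>F. h \<nu> = r}. (cmod (J (?\<mu> - \<nu>)))\<^sup>2)" for r
  have "(\<Sum>\<nu>\<in>F. (cmod (J (?\<mu> - \<nu>)))\<^sup>2) = (\<Sum>r\<in>?R. s r)"
    unfolding s_def using F R h_R by (intro sum.group[symmetric]) auto
  also have "\<dots> = s 1 + (\<Sum>r\<in>?R - {1}. s r)"
    using R by (intro sum.remove) auto
  also have "s 1 = 0"
    unfolding s_def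
  proof (rule sum.neutral, rule ballI)
    fix \<nu> assume "\<nu> \<in> {\<nu>\<in>F. h \<nu> = 1}"
    then have \<nu>: "\<nu> \<in> \<Lambda>" "h \<nu> = h \<kappa>" using F by (auto simp: h_def)
    have "of_int n - (\<nu> - \<kappa>) / 3 \<in> \<int>" using h_eq[OF \<nu>(1) \<kappa> \<nu>(2)] by simp
    moreover have "?\<mu> - \<nu> \<noteq> 0" using \<mu> \<nu> by auto
    ultimately have "J (?\<mu> - \<nu>) = 0" unfolding J_eq_0 by (simp add: field_simps)
    then show "(cmod (J (?\<mu> - \<nu>)))\<^sup>2 = 0" by simp
  qed
  also have "(\<Sum>r\<in>?R - {1}. s r) \<le> of_nat (card (?R - {1})) * (1/9)"
    unfolding s_def using F by (intro sum_bounded_above Bessel_class) (auto intro!: h_eq)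
  also have "\<dots> \<le> 2/9"
    using R by (simp add: card_Diff_singleton)
  finally show False using big by simp
qed

text \<open>
  A single class gives at most \<open>1/9\<close> in the Parseval sum at any point, here at 0.
\<close>

lemma spectrum_two_classes:
  obtains \<kappa> \<mu> where "\<kappa> \<in> \<Lambda>" "\<mu> \<in> \<Lambda>" "(\<kappa> - \<mu>) / 3 \<notin> \<int>"
proof -
  obtain F where F: "finite F" "F \<subseteq> \<Lambda>" "2/9 < (\<Sum>\<kappa>\<in>F. (cmod (J (0 - \<kappa>)))\<^sup>2)"
    by (rule Parseval_on_A)
  then have "\<not> (\<Sum>\<kappa>\<in>F. (cmod (J (0 - \<kappa>)))\<^sup>2) \<le> 1/9" by simp
  then show ?thesis using Bessel_class[of F 0] F that by blast
qed

text \<open>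
  For a difference \<open>\<sigma>\<close> between two classes, \<open>p = \<sigma> m\<close> and \<open>r = \<sigma> n\<close> are integers because the two
  exponentials at \<open>\<sigma>\<close> are cube roots of unity; \<open>r \<equiv> 2 p\<close> modulo 3 expresses that the second is the
  square of the first.
\<close>

lemma arithmetic_of_gaps:
  obtains m n p r :: int where "\<beta> = \<alpha> + m / 3" "\<gamma> = \<alpha> + n / 3"
    "p * n = r * m" "\<not> 3 dvd p" "3 dvd p + r"
proof -
  obtain \<kappa> \<mu> where \<Lambda>: "\<kappa> \<in> \<Lambda>" "\<mu> \<in> \<Lambda>" "(\<kappa> - \<mu>) / 3 \<notin> \<int>" by (rule spectrum_two_classes)
  define \<sigma> where "\<sigma> = \<kappa> - \<mu>"
  let ?z = "wave \<sigma> (\<beta> - \<alpha>)" and ?u = "wave 3 (\<beta> - \<alpha>)"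
  have prog: "wave (\<sigma> + 3 * of_int k) (\<beta> - \<alpha>) ^ 3 = 1 \<and> wave (\<sigma> + 3 * of_int k) (\<beta> - \<alpha>) \<noteq> 1 \<and>
    wave (\<sigma> + 3 * of_int k) (\<gamma> - \<alpha>) = (wave (\<sigma> + 3 * of_int k) (\<beta> - \<alpha>))\<^sup>2" for k :: int
  proof -
    have "(\<kappa> + 3 * of_int k - \<mu>) / 3 - of_int k = (\<kappa> - \<mu>) / 3" by (simp add: field_simps)
    moreover have "(\<kappa> + 3 * of_int k - \<mu>) / 3 - of_int k \<in> \<int>"
      if "(\<kappa> + 3 * of_int k - \<mu>) / 3 \<in> \<int>"
      using that by (rule Ints_diff) (rule Ints_of_int)
    ultimately have "(\<kappa> + 3 * of_int k - \<mu>) / 3 \<notin> \<int>"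
      using \<Lambda>(3) by argo
    moreover have eq: "\<kappa> + 3 * of_int k - \<mu> = \<sigma> + 3 * of_int k" by (simp add: \<sigma>_def)
    ultimately show ?thesis
      using difference_cases[OF spectrum_periodic[OF \<Lambda>(1), of k] \<Lambda>(2)] unfolding eq by blast
  qed
  have z0: "?z ^ 3 = 1" "?z \<noteq> 1" "wave \<sigma> (\<gamma> - \<alpha>) = ?z\<^sup>2" using prog[of 0] by auto
  have W1: "wave (\<sigma> + 3 * of_int 1) x = wave \<sigma> x * wave 3 x" for x
    by (simp add: wave_add_left)
  have W2: "wave (\<sigma> + 3 * of_int 2) x = wave \<sigma> x * wave 3 x * wave 3 x" for x
    using wave_add_left[of 3 3 x] by (simp add: wave_add_left)
  have u: "?u = 1"
    using cube_roots_progression[OF z0(1,2)] prog[of 1, unfolded W1] prog[of 2, unfolded W2] by blast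
  have "?z\<^sup>2 * wave 3 (\<gamma> - \<alpha>) = ?z\<^sup>2"
    using prog[of 1, unfolded W1 u z0(3)] by (simp only: mult_1_right)
  moreover have "?z\<^sup>2 \<noteq> 0" by simp
  ultimately have "wave 3 (\<gamma> - \<alpha>) = 1" by simp
  then obtain m n where mn: "3 * (\<beta> - \<alpha>) = of_int m" "3 * (\<gamma> - \<alpha>) = of_int n"
    using u unfolding wave_eq_1_iff by (elim Ints_cases)
  have "?z ^ 3 = wave \<sigma> (3 * (\<beta> - \<alpha>))"
    using wave_add_right[of \<sigma> "\<beta> - \<alpha>" "\<beta> - \<alpha>"] wave_add_right[of \<sigma> "2 * (\<beta> - \<alpha>)" "\<beta> - \<alpha>"]
    by (simp add: power3_eq_cube)
  then have "wave \<sigma> (of_int m) = 1" using z0(1) unfolding mn by simp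
  then obtain p where p: "\<sigma> * of_int m = of_int p"
    unfolding wave_eq_1_iff by (elim Ints_cases)
  have "\<not> 3 dvd p"
  proof
    assume "3 dvd p"
    then obtain k where "p = 3 * k" by (elim dvdE)
    then have "\<sigma> * (3 * (\<beta> - \<alpha>)) = 3 * of_int k" using p unfolding mn by simp
    then have "\<sigma> * (\<beta> - \<alpha>) = of_int k" by (simp add: right_diff_distrib)
    then show False using z0(2) unfolding wave_eq_1_iff by simp
  qed
  have "wave \<sigma> (\<gamma> - \<alpha>) = wave \<sigma> (2 * (\<beta> - \<alpha>))"
    using z0(3) wave_add_right[of \<sigma> "\<beta> - \<alpha>" "\<beta> - \<alpha>"] by (simp add: power2_eq_square)
  moreover have "wave \<sigma> (\<gamma> - \<alpha>) = wave \<sigma> (2 * (\<beta> - \<alpha>)) * wave \<sigma> (\<gamma> - \<alpha> - 2 * (\<beta> - \<alpha>))"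
    by (simp flip: wave_add_right)
  moreover have "wave \<sigma> (2 * (\<beta> - \<alpha>)) \<noteq> 0" by simp
  ultimately have "wave \<sigma> (\<gamma> - \<alpha> - 2 * (\<beta> - \<alpha>)) = 1" by simp
  then obtain q where q: "\<sigma> * (\<gamma> - \<alpha> - 2 * (\<beta> - \<alpha>)) = of_int q"
    unfolding wave_eq_1_iff by (elim Ints_cases)
  define r where "r = 2 * p + 3 * q"
  have "\<sigma> * of_int n = 3 * (\<sigma> * (\<gamma> - \<alpha> - 2 * (\<beta> - \<alpha>))) + 2 * (\<sigma> * of_int m)"
    by (simp add: algebra_simps flip: mn)
  then have r: "\<sigma> * of_int n = of_int r"
    unfolding q p by (simp add: r_def)
  have "real_of_int (p * n) = of_int (r * m)"
    by (simp add: mult_ac flip: p r)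
  then have "p * n = r * m" unfolding of_int_eq_iff .
  moreover have "3 dvd p + r" by (simp add: r_def)
  moreover have "\<beta> = \<alpha> + m / 3" "\<gamma> = \<alpha> + n / 3" using mn by (simp_all add: field_simps)
  ultimately show ?thesis using that \<open>\<not> 3 dvd p\<close> by blast
qed

end

section \<open>From integer tilings to tilings of the line\<close>

text \<open>
  Away from the grid points, which form a null set, a point is determined for the purpose of
  tiling by the grid cell that contains it.
\<close>

lemma tiles_by_integer_tiling:
  fixes D S :: "int set"
  assumes L: "L > 0"
    and lower: "\<And>c. c \<in> D \<Longrightarrow> {\<alpha> + c * L<..<\<alpha> + c * L + L} \<subseteq> \<Omega>"
    and upper: "\<Omega> \<subseteq> (\<Union>c\<in>D. {\<alpha> + of_int c * L..\<alpha> + of_int c * L + L})"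
    and tile: "\<And>N. \<exists>!c. c \<in> D \<and> N - c \<in> S"
  shows "tiles_by_translations \<Omega>"
proof -
  let ?G = "range (\<lambda>k::int. \<alpha> + of_int k * L)"
  let ?T = "(\<lambda>s. of_int s * L) ` S"
  define cell where "cell x = \<lfloor>(x - \<alpha>) / L\<rfloor>" for x
  have null: "X \<in> null_sets lebesgue" if "X \<subseteq> ?G" for X
    using countable_subset[OF that] by (intro null_sets_completionI countable_imp_null_set_lborel) auto
  have cell: "cell x - s \<in> D" if x: "x \<in> (+) (of_int s * L) ` \<Omega>" "x \<notin> ?G" for x s
  proof -
    obtain c where c: "c \<in> D" "x - of_int s * L \<in> {\<alpha> + of_int c * L..\<alpha> + of_int c * L + L}"
      using x(1) upper by fastforce
    have ne: "x \<noteq> \<alpha> + of_int (s + c + 1) * L" using x(2) by blast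
    have "of_int (s + c) * L \<le> x - \<alpha>" "x - \<alpha> \<le> (of_int (s + c) + 1) * L"
      using c(2) by (simp_all add: algebra_simps)
    moreover have "x - \<alpha> \<noteq> (of_int (s + c) + 1) * L" using ne by auto
    ultimately have "of_int (s + c) * L \<le> x - \<alpha>" "x - \<alpha> < (of_int (s + c) + 1) * L"
      by linarith+
    then have "of_int (s + c) \<le> (x - \<alpha>) / L" "(x - \<alpha>) / L < of_int (s + c) + 1"
      by (simp_all only: pos_le_divide_eq[OF L] pos_divide_less_eq[OF L])
    then have "cell x = s + c" unfolding cell_def by (intro floor_unique)
    with c show ?thesis by simp
  qed
  have "(+) s ` \<Omega> \<inter> (+) t ` \<Omega> \<in> null_sets lebesgue" if st: "s \<in> ?T" "t \<in> ?T" "s \<noteq> t" for s t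
  proof (rule null, rule subsetI, rule ccontr)
    fix x assume x: "x \<in> (+) s ` \<Omega> \<inter> (+) t ` \<Omega>" "x \<notin> ?G"
    obtain i j where ij: "i \<in> S" "s = of_int i * L" "j \<in> S" "t = of_int j * L" using st by auto
    have "cell x - i \<in> D" "cell x - j \<in> D" using cell x ij by auto
    moreover have "cell x - (cell x - i) \<in> S" "cell x - (cell x - j) \<in> S" using ij by auto
    ultimately have "cell x - i = cell x - j" using tile by blast
    then show False using st ij by simp
  qed
  moreover have "- (\<Union>t\<in>?T. (+) t ` \<Omega>) \<in> null_sets lebesgue"
  proof (rule null, rule subsetI, rule ccontr)
    fix x assume x: "x \<in> - (\<Union>t\<in>?T. (+) t ` \<Omega>)" "x \<notin> ?G"
    obtain c where c: "c \<in> D" "cell x - c \<in> S" using tile by blast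
    have "of_int (cell x) \<le> (x - \<alpha>) / L" "(x - \<alpha>) / L < of_int (cell x) + 1"
      unfolding cell_def by linarith+
    then have "of_int (cell x) * L \<le> x - \<alpha>" "x - \<alpha> < (of_int (cell x) + 1) * L"
      by (simp_all only: pos_le_divide_eq[OF L] pos_divide_less_eq[OF L])
    moreover have "x \<noteq> \<alpha> + of_int (cell x) * L" using x(2) by blast
    ultimately have "of_int (cell x) * L < x - \<alpha>" "x - \<alpha> < (of_int (cell x) + 1) * L"
      by linarith+
    then have "x - of_int (cell x - c) * L \<in> {\<alpha> + c * L<..<\<alpha> + c * L + L}"
      by (simp add: algebra_simps)
    then have "x - of_int (cell x - c) * L \<in> \<Omega>" using lower[OF c(1)] by blast
    then have "x \<in> (+) (of_int (cell x - c) * L) ` \<Omega>"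
      by (rule image_eqI[where x = "x - of_int (cell x - c) * L", rotated])
        (simp only: add_diff_cancel_left' diff_add_cancel add.commute)
    then show False using x c by blast
  qed
  ultimately show ?thesis unfolding tiles_by_translations_def by blast
qed

text \<open>
  Divide by \<open>d = gcd m n\<close>. Coprimality of \<open>m'\<close> and \<open>n'\<close> lets \<open>p\<close> and \<open>r\<close> be written as \<open>m' k\<close> and
  \<open>n' k\<close>. As 3 divides their sum but not \<open>p\<close>, it divides \<open>m' + n'\<close> but not \<open>m'\<close>, so that
  \<open>0, m', n'\<close> are the three residues modulo 3 and \<open>{0, m', n'}\<close> tiles with \<open>3\<int>\<close>. Blocks
  of \<open>d\<close> consecutive integers carry this over to \<open>{0, m, n}\<close>.
\<close>

lemma integer_tiling_of_triple:
  fixes m n p r :: int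
  assumes eq: "p * n = r * m" and p: "\<not> 3 dvd p" and pr: "3 dvd p + r" and m: "m \<noteq> 0"
  shows "\<exists>S. \<forall>N. \<exists>!c. c \<in> {0, m, n} \<and> N - c \<in> S"
proof -
  define d where "d = gcd m n"
  have d: "d > 0" using m by (simp add: d_def)
  have "gcd m n \<noteq> 0" using m by simp
  then obtain m' n' where "m = m' * d" "n = n' * d" and cop: "coprime m' n'"
    unfolding d_def by (blast dest: gcd_coprime_exists)
  then have mn: "m = d * m'" "n = d * n'" by (simp_all only: mult.commute)
  have m': "m' \<noteq> 0" using m mn by auto
  have eq': "p * n' = r * m'" using eq d by (simp add: mn)
  then have "m' dvd p * n'" by simp
  then have "m' dvd p" by (simp only: coprime_dvd_mult_left_iff[OF cop])
  then obtain k where k: "p = m' * k" by (elim dvdE)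
  have "m' * r = m' * (n' * k)" using eq' by (simp add: k ac_simps eq_commute[of r])
  then have rk: "r = n' * k" using m' by (simp only: mult_cancel_left simp_thms)
  have "p + r = (m' + n') * k" by (simp add: k rk distrib_right)
  with pr have "3 dvd (m' + n') * k" by simp
  moreover have "prime (3::int)" by simp
  ultimately have "3 dvd m' + n' \<or> 3 dvd k"
    by (simp only: prime_dvd_mult_iff)
  then have sum: "3 dvd m' + n'" and m3: "\<not> 3 dvd m'"
    using p unfolding k by auto
  let ?S = "{s. 3 dvd s div d}"
  have shift: "(N - d * x) div d = N div d - x" for N x
    using d div_mult_self2[of d N "-x"] by simp
  have "\<exists>!c. c \<in> {0, m, n} \<and> N - c \<in> ?S" for N
  proof -
    define q where "q = N div d"
    have S: "N \<in> ?S \<longleftrightarrow> 3 dvd q" "N - m \<in> ?S \<longleftrightarrow> 3 dvd q - m'" "N - n \<in> ?S \<longleftrightarrow> 3 dvd q - n'"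
      by (simp_all add: mn shift q_def)
    have "q + m' = (q - n') + (m' + n')" by simp
    then have "3 dvd q - n' \<longleftrightarrow> 3 dvd q + m'"
      using dvd_add_left_iff[OF sum, of "q - n'"] by (simp only:)
    moreover have "3 dvd q \<and> \<not> 3 dvd q - m' \<and> \<not> 3 dvd q + m' \<or>
        \<not> 3 dvd q \<and> 3 dvd q - m' \<and> \<not> 3 dvd q + m' \<or>
        \<not> 3 dvd q \<and> \<not> 3 dvd q - m' \<and> 3 dvd q + m'"
      using m3 by presburger
    ultimately consider "3 dvd q" "\<not> 3 dvd q - m'" "\<not> 3 dvd q - n'"
      | "\<not> 3 dvd q" "3 dvd q - m'" "\<not> 3 dvd q - n'"
      | "\<not> 3 dvd q" "\<not> 3 dvd q - m'" "3 dvd q - n'"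
      by blast
    then show ?thesis
    proof cases
      case 1
      with S show ?thesis by (intro ex1I[of _ 0]) auto
    next
      case 2
      with S show ?thesis by (intro ex1I[of _ m]) auto
    next
      case 3
      with S show ?thesis by (intro ex1I[of _ n]) auto
    qed
  qed
  then show ?thesis by blast
qed

section \<open>Spectral unions of three intervals tile\<close>

theorem mainTheorem2:
  fixes A B C :: "real set"
  assumes "is_interval A" and "is_interval B" and "is_interval C"
    and "A \<inter> B = {}" and "A \<inter> C = {}" and "B \<inter> C = {}"
    and "measure lebesgue A = 1/3" and "measure lebesgue B = 1/3" and "measure lebesgue C = 1/3"
    and "spectral_set (A \<union> B \<union> C)"
  shows "tiles_by_translations (A \<union> B \<union> C)"
proof -
  have ex: "\<exists>x. segment_at (1/3) x X" if "is_interval X" "measure lebesgue X = 1/3" for X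
    using segment_at_of_interval[OF that(1)] that(2) by (metis zero_less_divide_1_iff zero_less_numeral)
  obtain \<alpha> \<beta> \<gamma> where seg: "segment_at (1/3) \<alpha> A" "segment_at (1/3) \<beta> B" "segment_at (1/3) \<gamma> C"
    using ex[OF assms(1,7)] ex[OF assms(2,8)] ex[OF assms(3,9)] by blast
  note lm = seg[THEN segment_lmeasurable]
  have "measure lebesgue (A \<union> B \<union> C) = measure lebesgue (A \<union> B) + measure lebesgue C"
    using assms(5,6) lm by (intro measure_Un3[THEN trans]) (auto simp: Int_Un_distrib2)
  moreover have "measure lebesgue (A \<union> B) = measure lebesgue A + measure lebesgue B"
    using assms(4) lm by (intro measure_Un3[THEN trans]) auto
  ultimately have "measure lebesgue (A \<union> B \<union> C) = 1" using assms(7-9) by simp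
  then obtain \<Lambda> where "L2_orthonormal_basis (A \<union> B \<union> C) \<Lambda> wave"
    using assms(10) normalized_exponential_wave unfolding spectral_set_def by blast
  then interpret spectral_triple \<alpha> \<beta> \<gamma> A B C \<Lambda>
    using seg assms(4-6) by unfold_locales
  obtain m n p r :: int where mn: "\<beta> = \<alpha> + m / 3" "\<gamma> = \<alpha> + n / 3"
    and eqs: "p * n = r * m" "\<not> 3 dvd p" "3 dvd p + r"
    by (rule arithmetic_of_gaps)
  have "m \<noteq> 0"
  proof
    assume "m = 0"
    then have "\<beta> = \<alpha>" using mn by simp
    then have "\<alpha> + 1/6 \<in> {\<alpha><..<\<alpha> + 1/3} \<inter> {\<beta><..<\<beta> + 1/3}" by simp
    then have "\<alpha> + 1/6 \<in> A \<inter> B" using seg unfolding segment_at_def by blast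
    then show False using assms(4) by simp
  qed
  from integer_tiling_of_triple[OF eqs this]
  obtain S where "\<forall>N. \<exists>!c. c \<in> {0, m, n} \<and> N - c \<in> S"
    by (elim exE)
  note S = this[THEN spec]
  show ?thesis
  proof (rule tiles_by_integer_tiling[OF _ _ _ S])
    show "(1/3 :: real) > 0" by simp
    show "{\<alpha> + of_int c * (1/3)<..<\<alpha> + of_int c * (1/3) + 1/3} \<subseteq> A \<union> B \<union> C"
      if "c \<in> {0, m, n}" for c
    proof -
      have "{\<alpha> + of_int c * (1/3)<..<\<alpha> + of_int c * (1/3) + 1/3}
          \<in> {{\<alpha><..<\<alpha> + 1/3}, {\<beta><..<\<beta> + 1/3}, {\<gamma><..<\<gamma> + 1/3}}"
        using that unfolding mn by auto
      then show ?thesis using seg unfolding segment_at_def by blast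
    qed
    have "A \<union> B \<union> C \<subseteq> {\<alpha>..\<alpha> + 1/3} \<union> {\<beta>..\<beta> + 1/3} \<union> {\<gamma>..\<gamma> + 1/3}"
      using seg unfolding segment_at_def by blast
    also have "\<dots> = (\<Union>c\<in>{0, m, n}. {\<alpha> + of_int c * (1/3)..\<alpha> + of_int c * (1/3) + 1/3})"
      unfolding mn by (simp add: Un_assoc)
    finally show "A \<union> B \<union> C
        \<subseteq> (\<Union>c\<in>{0, m, n}. {\<alpha> + of_int c * (1/3)..\<alpha> + of_int c * (1/3) + 1/3})" .
  qed
qed

end
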